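(* Let $\mathbb{N}=\{1,2,3,\ldots\}$, let $f:\mathbb{N}\times\mathbb{N}\to\mathbb{N}$ be the function $f(n,m)=2^n m$, and let $\mathcal{U}$ be any ultrafilter on $\mathbb{N}$ that satisfies the following property: ($\star$) if $X\in\mathcal{U}$, then for every $\ell\in\mathbb{N}$ there exist $b,c\in\mathbb{N}$ with $\{b,c,b+\ell c\}\subseteq X$. Then for every $A\in f_*(\mathcal{U}\otimes\mathcal{U})$ there exist $x,y\in\mathbb{N}$ such that $\{x, y, 2^x y\}\subseteq A$.
   Context: For an ultrafilter $\mathcal{U}$ on a set $I$ and a function $g:I\to J$, the image ultrafilter $g_*(\mathcal{U})$ on $J$ is defined by $B\in g_*(\mathcal{U})\iff g^{-1}(B)\in\mathcal{U}$. For ultrafilters $\mathcal{U},\mathcal{V}$ on sets $I,J$, the tensor product $\mathcal{U}\otimes\mathcal{V}$ is the ultrafilter on $I\times J$ defined by $X\in\mathcal{U}\otimes\mathcal{V}\iff \{i\in I\mid \{j\in J\mid (i,j)\in X\}\in\mathcal{V}\}\in\mathcal{U}$. *)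

theory Defs
  imports Main
begin

text \<open>
  Ultrafilters live on an explicit carrier set and are families of subsets of it. The type
  \<open>'a filter\<close> of the library is not used because it has no carrier, and its
  products do not include the (non-commutative) tensor product.
\<close>

definition ultrafilter_on :: "'a set \<Rightarrow> 'a set set \<Rightarrow> bool" where
  "ultrafilter_on I U \<longleftrightarrow>
     U \<subseteq> Pow I \<and> I \<in> U \<and> {} \<notin> U \<and>
     (\<forall>A\<in>U. \<forall>B\<in>U. A \<inter> B \<in> U) \<and>
     (\<forall>A\<in>U. \<forall>B. A \<subseteq> B \<and> B \<subseteq> I \<longrightarrow> B \<in> U) \<and>
     (\<forall>A. A \<subseteq> I \<longrightarrow> A \<in> U \<or> I - A \<in> U)"

definition image_ultrafilter ::
  "'a set \<Rightarrow> 'b set \<Rightarrow> ('a \<Rightarrow> 'b) \<Rightarrow> 'a set set \<Rightarrow> 'b set set" where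
  "image_ultrafilter I J g U = {B. B \<subseteq> J \<and> {i \<in> I. g i \<in> B} \<in> U}"

definition tensor_ultrafilter ::
  "'a set \<Rightarrow> 'b set \<Rightarrow> 'a set set \<Rightarrow> 'b set set \<Rightarrow> ('a \<times> 'b) set set" where
  "tensor_ultrafilter I J U V =
     {X. X \<subseteq> I \<times> J \<and> {i \<in> I. {j \<in> J. (i, j) \<in> X} \<in> V} \<in> U}"

lemma ultrafilter_on_image:
  assumes "ultrafilter_on I U" and "g ` I \<subseteq> J"
  shows "ultrafilter_on J (image_ultrafilter I J g U)"
proof -
  have int: "A \<inter> B \<in> U" if "A \<in> U" "B \<in> U" for A B
    using assms(1) that unfolding ultrafilter_on_def by blast
  have up: "B \<in> U" if "A \<in> U" "A \<subseteq> B" "B \<subseteq> I" for A B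
    using assms(1) that unfolding ultrafilter_on_def by blast
  have ultra: "A \<in> U \<or> I - A \<in> U" if "A \<subseteq> I" for A
    using assms(1) that unfolding ultrafilter_on_def by blast
  have triv: "I \<in> U" "{} \<notin> U"
    using assms(1) unfolding ultrafilter_on_def by blast+
  have J: "{i \<in> I. g i \<in> J} = I" using assms(2) by blast
  have i: "{i \<in> I. g i \<in> A \<and> g i \<in> B} = {i \<in> I. g i \<in> A} \<inter> {i \<in> I. g i \<in> B}" for A B
    by blast
  have c: "{i \<in> I. g i \<in> J \<and> g i \<notin> A} = I - {i \<in> I. g i \<in> A}" for A
    using assms(2) by blast
  have mono: "{i \<in> I. g i \<in> B} \<in> U" if "{i \<in> I. g i \<in> A} \<in> U" "A \<subseteq> B" for A B
    by (rule up[OF that(1)]) (use that(2) in auto)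
  have d: "{i \<in> I. g i \<in> A} \<in> U \<or> I - {i \<in> I. g i \<in> A} \<in> U" for A
    by (rule ultra) blast
  show ?thesis
    unfolding ultrafilter_on_def image_ultrafilter_def
    using triv int d by (auto simp: J i c intro: mono)
qed

lemma ultrafilter_on_tensor:
  assumes U: "ultrafilter_on I U" and V: "ultrafilter_on J V"
  shows "ultrafilter_on (I \<times> J) (tensor_ultrafilter I J U V)"
proof -
  define S where "S X i = {j \<in> J. (i, j) \<in> X}" for X :: "('a \<times> 'b) set" and i
  define T where "T X = {i \<in> I. S X i \<in> V}" for X
  have SJ: "S X i \<subseteq> J" and TI: "T X \<subseteq> I" for X i
    by (auto simp: S_def T_def)
  have intU: "A \<inter> B \<in> U" if "A \<in> U" "B \<in> U" for A B
    using U that unfolding ultrafilter_on_def by blast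
  have upU: "B \<in> U" if "A \<in> U" "A \<subseteq> B" "B \<subseteq> I" for A B
    using U that unfolding ultrafilter_on_def by blast
  have ultraU: "A \<in> U \<or> I - A \<in> U" if "A \<subseteq> I" for A
    using U that unfolding ultrafilter_on_def by blast
  have trivU: "I \<in> U" "{} \<notin> U"
    using U unfolding ultrafilter_on_def by blast+
  have intV: "A \<inter> B \<in> V" if "A \<in> V" "B \<in> V" for A B
    using V that unfolding ultrafilter_on_def by blast
  have upV: "B \<in> V" if "A \<in> V" "A \<subseteq> B" "B \<subseteq> J" for A B
    using V that unfolding ultrafilter_on_def by blast
  have ultraV: "A \<in> V \<or> J - A \<in> V" if "A \<subseteq> J" for A
    using V that unfolding ultrafilter_on_def by blast
  have trivV: "J \<in> V" "{} \<notin> V"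
    using V unfolding ultrafilter_on_def by blast+
  have Smono: "S X i \<subseteq> S Y i" if "X \<subseteq> Y" for X Y i
    using that by (auto simp: S_def)
  have Tmono: "T X \<subseteq> T Y" if "X \<subseteq> Y" for X Y
    unfolding T_def using upV[OF _ Smono[OF that] SJ] by blast
  have Sfull: "S (I \<times> J) i = J" if "i \<in> I" for i
    using that by (auto simp: S_def)
  have full: "T (I \<times> J) = I"
    using trivV Sfull by (auto simp: T_def)
  have empty: "T {} = {}"
    using trivV by (auto simp: T_def S_def)
  have Sint: "S (X \<inter> Y) i = S X i \<inter> S Y i" for X Y i
    by (auto simp: S_def)
  have Tint: "T X \<inter> T Y \<subseteq> T (X \<inter> Y)" for X Y
    using intV by (auto simp: T_def Sint)
  have Scomp: "S (I \<times> J - X) i = J - S X i" if "i \<in> I" for X i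
    using that by (auto simp: S_def)
  have Tcomp: "I - T X \<subseteq> T (I \<times> J - X)" for X
    using ultraV[OF SJ] unfolding T_def by (force simp: Scomp)
  have tensor: "tensor_ultrafilter I J U V = {X. X \<subseteq> I \<times> J \<and> T X \<in> U}"
    by (simp add: tensor_ultrafilter_def T_def S_def)
  have A1: "T (X \<inter> Y) \<in> U" if "T X \<in> U" "T Y \<in> U" for X Y
    using upU[OF intU[OF that] Tint TI] .
  have A2: "T Y \<in> U" if "T X \<in> U" "X \<subseteq> Y" for X Y
    using upU[OF that(1) Tmono[OF that(2)] TI] .
  have A3: "T X \<in> U \<or> T (I \<times> J - X) \<in> U" for X
    using ultraU[OF TI] upU[OF _ Tcomp TI] by blast
  show ?thesis
    unfolding ultrafilter_on_def tensor
    using trivU full empty A1 A2 A3 by auto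
qed

end

theory Submission
  imports Defs
begin

text \<open>
  Let \<open>S n = {m. 2^n * m \<in> A}\<close> and \<open>X = {n. S n \<in> U}\<close>, so \<open>X \<in> U\<close>. Fix \<open>a \<in> X\<close> and apply the
  hypothesis to \<open>X \<inter> S a \<in> U\<close> with the coefficient \<open>2^a\<close>: this gives \<open>b\<close>, \<open>c\<close> and
  \<open>b + 2^a * c\<close> in it. For any \<open>m \<in> S b \<inter> S (b + 2^a * c)\<close>, the numbers \<open>x = 2^a * c\<close> and
  \<open>y = 2^b * m\<close> are as required, since \<open>2^x * y = 2^(b + 2^a * c) * m\<close>.
\<close>

theorem theorem1:
  fixes N :: "nat set" and f :: "nat \<times> nat \<Rightarrow> nat" and U :: "nat set set"
  defines "N \<equiv> {1..}"
    and "f \<equiv> (\<lambda>(n, m). 2 ^ n * m)"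
  assumes "ultrafilter_on N U"
    and "\<And>X l. X \<in> U \<Longrightarrow> l \<in> N \<Longrightarrow> \<exists>b\<in>N. \<exists>c\<in>N. {b, c, b + l * c} \<subseteq> X"
  shows "\<forall>A \<in> image_ultrafilter (N \<times> N) N f (tensor_ultrafilter N N U U).
           \<exists>x\<in>N. \<exists>y\<in>N. {x, y, 2 ^ x * y} \<subseteq> A"
proof
  fix A assume A: "A \<in> image_ultrafilter (N \<times> N) N f (tensor_ultrafilter N N U U)"
  have int: "B \<inter> C \<in> U" if "B \<in> U" "C \<in> U" for B C
    using assms(3) that unfolding ultrafilter_on_def by blast
  have ne: "B \<noteq> {}" if "B \<in> U" for B
    using assms(3) that unfolding ultrafilter_on_def by blast
  define S where "S n = {m \<in> N. 2 ^ n * m \<in> A}" for n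
  define X where "X = {n \<in> N. S n \<in> U}"
  have AN: "A \<subseteq> N"
    using A by (simp add: image_ultrafilter_def)
  \<comment> \<open>The repeated guards \<open>i \<in> N\<close> and \<open>j \<in> N\<close> come
    from taking the preimage of \<open>A\<close> under \<open>f\<close> inside
    \<open>N \<times> N\<close>.\<close>
  have "{i \<in> N. {j \<in> N. i \<in> N \<and> j \<in> N \<and> 2 ^ i * j \<in> A} \<in> U} \<in> U"
    using A by (simp add: image_ultrafilter_def tensor_ultrafilter_def f_def)
  also have "{i \<in> N. {j \<in> N. i \<in> N \<and> j \<in> N \<and> 2 ^ i * j \<in> A} \<in> U} = X"
    unfolding X_def S_def by (intro Collect_cong conj_cong refl) simp
  finally have XU: "X \<in> U" .
  then obtain a where a: "a \<in> X"
    using ne by blast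
  then have "X \<inter> S a \<in> U"
    using XU int by (simp add: X_def)
  moreover have "2 ^ a \<in> N"
    by (simp add: N_def)
  ultimately obtain b c where bc: "{b, c, b + 2 ^ a * c} \<subseteq> X \<inter> S a"
    using assms(4) by blast
  then have "S b \<inter> S (b + 2 ^ a * c) \<in> U"
    by (intro int) (auto simp: X_def)
  then obtain m where m: "m \<in> S b" "m \<in> S (b + 2 ^ a * c)"
    using ne by blast
  \<comment> \<open>The first membership is \<open>c \<in> S a\<close>, the reason for intersecting
    \<open>X\<close> with \<open>S a\<close>; the second is \<open>m \<in> S b\<close>.\<close>
  have "2 ^ a * c \<in> A" "2 ^ b * m \<in> A"
    using bc m by (auto simp: S_def)
  moreover have "2 ^ (2 ^ a * c) * (2 ^ b * m) \<in> A"
    using m(2) by (simp add: S_def power_add ac_simps)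
  \<comment> \<open>Both witnesses lie in \<open>A\<close>, so \<open>A \<subseteq> N\<close> makes
    them positive.\<close>
  ultimately show "\<exists>x\<in>N. \<exists>y\<in>N. {x, y, 2 ^ x * y} \<subseteq> A"
    using AN by blast
qed

end
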